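(* Assume the Gaussian limit-layer hypotheses stated in the context for the $N\times N$ trained limit layer $W_2^*(N)=S_2^*(N)+R_2^*(N)$, where $R_2^*(N)$ has iid entries $R_2^*(N)_{ij}\sim N(0,g_*(N)/N)$; these include the vanishing of the propagated perturbation scale, $a_\phi(N,s)\to 0$ for all $s\in T$, and of the stationarity error, $\epsilon_N\to0$ in probability. Then $$\|R_2^*(N)\|_F\to0\quad\text{in probability as }N\to\infty.$$ If, moreover, there is a decomposition $W_2(t,N)=S_2(t,N)+R_2(t,N)$ of the layer matrix along the training path such that for each fixed $N$ $$\|S_2(t,N)-S_2^*(N)\|_F+\|R_2(t,N)-R_2^*(N)\|_F\to0\quad\text{in probability as }t\to\infty,$$ then for every $\epsilon>0$, $$\lim_{N\to\infty}\lim_{t\to\infty}\mathbb P\big(\|R_2(t,N)\|_F\le\epsilon\big)=1.$$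
   Context: Setting. For each $N$ there is a classifier network $\phi(\cdot,\alpha)=\rho\circ X(\cdot,\alpha)$ with $K$ classes and weight matrices $W_i$; $\rho(v)_i=e^{v_i}/\sum_{j=1}^K e^{v_j}$, $X(s,\alpha)\in\mathbb R^K$ are the logits. $T$ is a finite nonempty training set, fixed independently of $N$, with correct classes $C(s)\in\{1,\dots,K\}$. For $\lambda_{\mathrm{reg}}>0$ the loss is $$L(\alpha)=-\frac1{|T|}\sum_{s\in T}\log\big(\phi_{C(s)}(s,\alpha)\big)+\lambda_{\mathrm{reg}}\sum_i\|W_i\|_F^2 .$$ Gaussian limit-layer hypotheses. (i) For each $N$ the random training path $\alpha(t,N)$ converges in probability as $t\to\infty$ to $\alpha^*(N)$, whose distinguished $N\times N$ layer matrix is $W_2^*(N)=S_2^*(N)+R_2^*(N)$. At $\alpha^*(N)$, $\phi=\rho\circ\psi_2\circ(R_2^*(N)+S_2^*(N))\circ\psi_1$, where $\psi_1$ (values in $\mathbb R^N$) and $\psi_2:\mathbb R^N\to\mathbb R^K$ may depend on $N$ and on the remaining parameters. (ii) Conditionally on $(S_2^*(N),\psi_1,\psi_2)$ the entries of $R_2^*(N)$ are iid $N(0,g_*(N)/N)$, with $g_*(N)\ge0$ deterministic. (iii) For each $s\in T$ there is a set $\mathcal U_s\supseteq\{(S_2^*(N)+\vartheta R_2^*(N))\psi_1(s):\vartheta\in[0,1]\}$ with $$L_{\psi_2}(s):=\sup_{v,w\in\mathcal U_s,\,v\ne w}\frac{\|\psi_2(v)-\psi_2(w)\|_\infty}{\|v-w\|_\infty}<\infty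 .$$ (iv) There are nonnegative $d_1(N),d_2(N)\to0$ and a nonnegative function $J(v)$ of $v$ only such that for every $v$ measurable with respect to $\sigma(S_2^*(N),\psi_1,\psi_2)$, $\mathbb P(\|R_2^*(N)v\|_\infty>d_1(N)J(v)\mid S_2^*(N),\psi_1,\psi_2)\le d_2(N)$. (v) With $a_\phi(N,s):=J(\psi_1(s))L_{\psi_2}(s)d_1(N)$, for all $s\in T$ one has $a_\phi(N,s)\to0$ as $N\to\infty$ (in probability if random). (vi) $\langle S_2^*(N),R_2^*(N)\rangle_F\to0$ in probability as $N\to\infty$. (vii) Let $\alpha^*_\vartheta(N)$ denote $\alpha^*(N)$ with $W_2^*(N)$ replaced by $S_2^*(N)+\vartheta R_2^*(N)$. There are nonnegative random variables $\epsilon_N\to0$ in probability such that the event $\liminf_{h\downarrow0}h^{-1}\big(L(\alpha^*_{1-h}(N))-L(\alpha^*(N))\big)\ge-\epsilon_N$ has probability tending to one. $\|\cdot\|_F$, $\langle\cdot,\cdot\rangle_F$ are the Frobenius norm and inner product; $\|\cdot\|_\infty$ of a vector is the maximum norm. *)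

theory Defs
  imports "HOL-Probability.Probability" "Jordan_Normal_Form.Matrix"
begin

unbundle no vec_syntax

text \<open>Vectors and matrices of varying dimension are those of Jordan_Normal_Form, indexed from 0.\<close>

definition max_norm :: "real vec \<Rightarrow> real" where
  "max_norm v = Max (insert 0 ((\<lambda>i. \<bar>v $ i\<bar>) ` {..<dim_vec v}))"

definition frob_inner :: "real mat \<Rightarrow> real mat \<Rightarrow> real" where
  "frob_inner A B = (\<Sum>i<dim_row A. \<Sum>j<dim_col A. A $$ (i, j) * B $$ (i, j))"

definition frob_norm :: "real mat \<Rightarrow> real" where
  "frob_norm A = sqrt (\<Sum>i<dim_row A. \<Sum>j<dim_col A. (A $$ (i, j))\<^sup>2)"


text \<open>A parameter consists of the weight matrices \<open>W\<^sub>i\<close>, of which only those with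
  \<open>i \<in> {1..nl}\<close> are part of the network, and a vector holding all remaining (e.g. bias)
  parameters.\<close>

type_synonym params = "(nat \<Rightarrow> real mat) \<times> real vec"

definition param_space :: "nat \<Rightarrow> (nat \<Rightarrow> nat) \<Rightarrow> (nat \<Rightarrow> nat) \<Rightarrow> nat \<Rightarrow> params set" where
  "param_space nl nr nc nb =
     {\<alpha>. (\<forall>i\<in>{1..nl}. fst \<alpha> i \<in> carrier_mat (nr i) (nc i)) \<and> snd \<alpha> \<in> carrier_vec nb}"

definition param_dist :: "nat \<Rightarrow> params \<Rightarrow> params \<Rightarrow> real" where
  "param_dist nl \<alpha> \<beta> =
     sqrt ((\<Sum>i=1..nl. (frob_norm (fst \<alpha> i - fst \<beta> i))\<^sup>2)
           + (\<Sum>k<dim_vec (snd \<alpha>). (snd \<alpha> $ k - snd \<beta> $ k)\<^sup>2))"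

definition replace_W2 :: "params \<Rightarrow> real mat \<Rightarrow> params" where
  "replace_W2 \<alpha> V = ((fst \<alpha>)(2 := V), snd \<alpha>)"

definition softmax :: "real vec \<Rightarrow> real vec" where
  "softmax v = vec (dim_vec v) (\<lambda>i. exp (v $ i) / (\<Sum>j<dim_vec v. exp (v $ j)))"

text \<open>\<open>X s \<alpha>\<close> are the logits. The classes are numbered from 0, like the vector entries.\<close>

definition loss ::
  "('s \<Rightarrow> params \<Rightarrow> real vec) \<Rightarrow> 's set \<Rightarrow> ('s \<Rightarrow> nat) \<Rightarrow> real \<Rightarrow> nat \<Rightarrow> params \<Rightarrow> real" where
  "loss X T C lam nl \<alpha> =
     - (1 / real (card T)) * (\<Sum>s\<in>T. ln (softmax (X s \<alpha>) $ C s))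
     + lam * (\<Sum>i=1..nl. (frob_norm (fst \<alpha> i))\<^sup>2)"

text \<open>Working in \<open>ennreal\<close> makes the supremum over the empty set (no two distinct points) 0.\<close>

definition lip_const :: "(real vec \<Rightarrow> real vec) \<Rightarrow> real vec set \<Rightarrow> ennreal" where
  "lip_const \<psi> U =
     (SUP (v, w) \<in> {(v, w). v \<in> U \<and> w \<in> U \<and> v \<noteq> w}.
        ennreal (max_norm (\<psi> v - \<psi> w) / max_norm (v - w)))"

definition a_phi ::
  "(real vec \<Rightarrow> real) \<Rightarrow> real \<Rightarrow> real vec \<Rightarrow> (real vec \<Rightarrow> real vec) \<Rightarrow> real vec set \<Rightarrow> real" where
  "a_phi J d1 x \<psi> U = J x * enn2real (lip_const \<psi> U) * d1"


definition random_vec :: "'w measure \<Rightarrow> nat \<Rightarrow> ('w \<Rightarrow> real vec) \<Rightarrow> bool" where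
  "random_vec M n v \<longleftrightarrow>
     (\<forall>\<omega>\<in>space M. v \<omega> \<in> carrier_vec n) \<and> (\<forall>i<n. (\<lambda>\<omega>. v \<omega> $ i) \<in> borel_measurable M)"

definition random_mat :: "'w measure \<Rightarrow> nat \<Rightarrow> nat \<Rightarrow> ('w \<Rightarrow> real mat) \<Rightarrow> bool" where
  "random_mat M n m A \<longleftrightarrow>
     (\<forall>\<omega>\<in>space M. A \<omega> \<in> carrier_mat n m) \<and>
     (\<forall>i<n. \<forall>j<m. (\<lambda>\<omega>. A \<omega> $$ (i, j)) \<in> borel_measurable M)"

definition random_params ::
  "'w measure \<Rightarrow> nat \<Rightarrow> (nat \<Rightarrow> nat) \<Rightarrow> (nat \<Rightarrow> nat) \<Rightarrow> nat \<Rightarrow> ('w \<Rightarrow> params) \<Rightarrow> bool" where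
  "random_params M nl nr nc nb \<alpha> \<longleftrightarrow>
     (\<forall>\<omega>\<in>space M. \<alpha> \<omega> \<in> param_space nl nr nc nb) \<and>
     (\<forall>i\<in>{1..nl}. random_mat M (nr i) (nc i) (\<lambda>\<omega>. fst (\<alpha> \<omega>) i)) \<and>
     random_vec M nb (\<lambda>\<omega>. snd (\<alpha> \<omega>))"

text \<open>Convergence to 0 in probability along a filter; the random variables may live on different
  probability spaces. Measurability is part of the notion, since \<open>measure\<close> assigns 0 to
  non-measurable sets.\<close>

definition tends_to_0_in_prob :: "('i \<Rightarrow> 'w measure) \<Rightarrow> ('i \<Rightarrow> 'w \<Rightarrow> real) \<Rightarrow> 'i filter \<Rightarrow> bool" where
  "tends_to_0_in_prob M X F \<longleftrightarrow>
     (\<forall>\<^sub>F i in F. X i \<in> borel_measurable (M i)) \<and>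
     (\<forall>\<epsilon>>0. ((\<lambda>i. measure (M i) {\<omega> \<in> space (M i). \<bar>X i \<omega>\<bar> > \<epsilon>}) \<longlongrightarrow> 0) F)"

text \<open>The normal distribution with mean 0 and variance \<open>\<sigma>2 \<ge> 0\<close>; variance 0 gives the
  point mass at 0, which has no density.\<close>

definition centered_normal :: "real \<Rightarrow> real measure" where
  "centered_normal \<sigma>2 =
     (if \<sigma>2 = 0 then return borel 0 else density lborel (normal_density 0 (sqrt \<sigma>2)))"

text \<open>The \<open>\<sigma>\<close>-algebra \<open>\<sigma>(S, \<psi>\<^sub>1, \<psi>\<^sub>2)\<close>: the random maps
  \<open>\<psi>\<^sub>1\<close> (into \<open>\<real>\<^sup>N\<close>) and \<open>\<psi>\<^sub>2\<close> (from \<open>\<real>\<^sup>N\<close> to \<open>\<real>\<^sup>K\<close>) generate it through their point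
  evaluations, i.e. function spaces carry the product \<open>\<sigma>\<close>-algebra.\<close>

definition info_algebra ::
  "'w measure \<Rightarrow> nat \<Rightarrow> nat \<Rightarrow> ('w \<Rightarrow> real mat) \<Rightarrow> ('w \<Rightarrow> 's \<Rightarrow> real vec)
     \<Rightarrow> ('w \<Rightarrow> real vec \<Rightarrow> real vec) \<Rightarrow> 'w measure" where
  "info_algebra M N K S \<psi>1 \<psi>2 =
     sigma (space M)
       ({(\<lambda>\<omega>. S \<omega> $$ (i, j)) -` B \<inter> space M | i j B. i < N \<and> j < N \<and> B \<in> sets borel}
        \<union> {(\<lambda>\<omega>. \<psi>1 \<omega> s $ i) -` B \<inter> space M | s i B. i < N \<and> B \<in> sets borel}
        \<union> {(\<lambda>\<omega>. \<psi>2 \<omega> v $ k) -` B \<inter> space M | v k B.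
              v \<in> carrier_vec N \<and> k < K \<and> B \<in> sets borel})"

text \<open>Conditional probability of an event \<open>A\<close> given a sub-\<open>\<sigma>\<close>-algebra \<open>G\<close>; meaningful only
  if \<open>A \<in> sets M\<close>.\<close>

definition cond_prob_alg :: "'w measure \<Rightarrow> 'w measure \<Rightarrow> 'w set \<Rightarrow> 'w \<Rightarrow> real" where
  "cond_prob_alg M G A = real_cond_exp M G (indicator A)"

text \<open>Conditionally on \<open>G\<close>, the entries of the \<open>n \<times> m\<close> matrix \<open>R\<close> are independent with law \<open>\<mu>\<close>
  (it suffices to state the joint conditional law on measurable rectangles).\<close>

definition cond_iid_entries ::
  "'w measure \<Rightarrow> 'w measure \<Rightarrow> nat \<Rightarrow> nat \<Rightarrow> ('w \<Rightarrow> real mat) \<Rightarrow> real measure \<Rightarrow> bool" where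
  "cond_iid_entries M G n m R \<mu> \<longleftrightarrow>
     (\<forall>B. (\<forall>i<n. \<forall>j<m. B i j \<in> sets borel) \<longrightarrow>
        (AE \<omega> in M.
           cond_prob_alg M G {\<omega>' \<in> space M. \<forall>i<n. \<forall>j<m. R \<omega>' $$ (i, j) \<in> B i j} \<omega>
           = (\<Prod>i<n. \<Prod>j<m. measure \<mu> (B i j))))"

end

theory Submission
  imports Defs
begin

text \<open>Shrinking \<open>R\<close> to \<open>(1 - h) R\<close> changes the regularizer to first order by
  \<open>- 2 \<lambda> h (\<langle>S, R\<rangle> + \<parallel>R\<parallel>\<^sup>2)\<close>, while, by the Lipschitz bounds for log-softmax and \<open>\<psi>\<^sub>2\<close>, the
  cross entropy changes by at most \<open>2 h\<close> times the mean of the \<open>a\<^sub>\<phi>(s)\<close>, off an event of vanishing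
  probability. Approximate stationarity therefore forces
  \<open>2 \<lambda> \<parallel>R\<parallel>\<^sup>2 \<le> \<epsilon>\<^sub>N + 2 mean a\<^sub>\<phi> - 2 \<lambda> \<langle>S, R\<rangle>\<close>, whose right-hand side vanishes in probability.
  Gaussianity matters only for the second claim: the inner limit in \<open>t\<close> exists because
  \<open>\<epsilon> > 0\<close> is not an atom of \<open>\<parallel>R\<parallel>\<close>, so that the distribution function of \<open>\<parallel>R\<parallel>\<close> is
  continuous there.\<close>

subsection \<open>The loss along the segment to the trained layer\<close>

lemma frob_norm_L2_set:
  "frob_norm A = L2_set (\<lambda>p. A $$ p) ({..<dim_row A} \<times> {..<dim_col A})"
  unfolding frob_norm_def L2_set_def by (simp add: sum.cartesian_product)

lemma frob_norm_nonneg [simp]: "frob_norm A \<ge> 0"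
  unfolding frob_norm_L2_set by simp

lemma frob_norm_power2: "(frob_norm A)\<^sup>2 = frob_inner A A"
  unfolding frob_norm_def frob_inner_def by (simp add: sum_nonneg power2_eq_square)

lemma frob_norm_triangle_sub:
  assumes "A \<in> carrier_mat n m" "B \<in> carrier_mat n m"
  shows "\<bar>frob_norm A - frob_norm B\<bar> \<le> frob_norm (A - B)"
proof -
  let ?I = "{..<n} \<times> {..<m}"
  \<comment> \<open>Minkowski for \<open>L2_set\<close> over index pairs is applied twice, to
    \<open>A = (A - B) + B\<close> and to \<open>B = - (A - B) + A\<close>, once for each sign of
    the difference of norms.\<close>
  have "L2_set (\<lambda>p. A $$ p) ?I = L2_set (\<lambda>p. (A - B) $$ p + B $$ p) ?I"
    "L2_set (\<lambda>p. B $$ p) ?I = L2_set (\<lambda>p. - (A - B) $$ p + A $$ p) ?I"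
    using assms by (auto intro!: L2_set_cong)
  moreover have "L2_set (\<lambda>p. - (A - B) $$ p) ?I = L2_set (\<lambda>p. (A - B) $$ p) ?I"
    unfolding L2_set_def by simp
  ultimately show ?thesis
    using L2_set_triangle_ineq[of "\<lambda>p. (A - B) $$ p" "\<lambda>p. B $$ p" ?I]
      L2_set_triangle_ineq[of "\<lambda>p. - (A - B) $$ p" "\<lambda>p. A $$ p" ?I] assms
    unfolding frob_norm_L2_set by auto
qed

lemma frob_norm_power2_add_smult:
  assumes "A \<in> carrier_mat n m" "B \<in> carrier_mat n m"
  shows "(frob_norm (A + c \<cdot>\<^sub>m B))\<^sup>2
    = (frob_norm A)\<^sup>2 + 2 * c * frob_inner A B + c\<^sup>2 * (frob_norm B)\<^sup>2"
  using assms unfolding frob_norm_power2 frob_inner_def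
  by (simp add: sum_distrib_left sum.distrib[symmetric] power2_eq_square algebra_simps)

section \<open>The maximum norm and Lipschitz constants\<close>

lemma max_norm_ge: "i < dim_vec v \<Longrightarrow> \<bar>v $ i\<bar> \<le> max_norm v"
  unfolding max_norm_def by (intro Max_ge) auto

lemma max_norm_le_iff: "max_norm v \<le> c \<longleftrightarrow> 0 \<le> c \<and> (\<forall>i<dim_vec v. \<bar>v $ i\<bar> \<le> c)"
  unfolding max_norm_def by (subst Max_le_iff) auto

lemma max_norm_nonneg [simp]: "max_norm v \<ge> 0"
  unfolding max_norm_def by (intro Max_ge) auto

lemma max_norm_minus_pos:
  assumes "v \<in> carrier_vec n" "w \<in> carrier_vec n" "v \<noteq> w"
  shows "max_norm (v - w) > 0"
proof (rule ccontr)
  assume "\<not> max_norm (v - w) > 0"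
  then have "max_norm (v - w) \<le> 0" by simp
  then have "v = w"
    using assms(1,2) unfolding max_norm_le_iff by (intro eq_vecI) auto
  with assms(3) show False by simp
qed

text \<open>The supremum in \<open>lip_const\<close> ranges over distinct points only, so equal
  points are treated apart. Finiteness matters because \<open>enn2real\<close> sends infinity to 0,
  for which the bound would fail in general.\<close>

lemma max_norm_lip_const:
  assumes "U \<subseteq> carrier_vec n" "v \<in> U" "w \<in> U" "lip_const \<psi> U < \<infinity>"
    "\<psi> v \<in> carrier_vec k"
  shows "max_norm (\<psi> v - \<psi> w) \<le> enn2real (lip_const \<psi> U) * max_norm (v - w)"
proof (cases "v = w")
  case True
  then show ?thesis using assms(5) by (simp add: max_norm_le_iff)
next
  case False
  have pos: "max_norm (v - w) > 0"
    using assms False by (intro max_norm_minus_pos[of _ n]) auto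
  have "ennreal (max_norm (\<psi> v - \<psi> w) / max_norm (v - w)) \<le> lip_const \<psi> U"
    unfolding lip_const_def using assms False by (intro SUP_upper2[of "(v, w)"]) auto
  then have "max_norm (\<psi> v - \<psi> w) / max_norm (v - w) \<le> enn2real (lip_const \<psi> U)"
    using assms(4) by (metis enn2real_ennreal enn2real_mono divide_nonneg_nonneg max_norm_nonneg infinity_ennreal_def)
  then show ?thesis using pos by (simp add: pos_divide_le_eq)
qed

section \<open>Log-softmax as a Lipschitz function of the logits\<close>

lemma ln_softmax:
  assumes "v \<in> carrier_vec K" "c < K"
  shows "ln (softmax v $ c) = v $ c - ln (\<Sum>j<K. exp (v $ j))"
proof -
  have "(\<Sum>j<K. exp (v $ j)) > 0" using assms(2) by (intro sum_pos) auto
  then show ?thesis using assms unfolding softmax_def by (simp add: ln_div)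
qed

text \<open>Log-sum-exp is monotone, and adding \<open>D\<close> to every exponent multiplies the
  sum by \<open>exp D\<close>, which shifts the logarithm by exactly \<open>D\<close>.\<close>

lemma ln_sum_exp_le:
  fixes f g :: "'a \<Rightarrow> real"
  assumes "finite I" "I \<noteq> {}" "\<And>i. i \<in> I \<Longrightarrow> f i \<le> g i + D"
  shows "ln (\<Sum>i\<in>I. exp (f i)) \<le> ln (\<Sum>i\<in>I. exp (g i)) + D"
proof -
  have "(\<Sum>i\<in>I. exp (f i)) \<le> (\<Sum>i\<in>I. exp (g i + D))"
    using assms by (intro sum_mono) auto
  also have "\<dots> = (\<Sum>i\<in>I. exp (g i)) * exp D"
    by (simp add: exp_add sum_distrib_right)
  finally have "ln (\<Sum>i\<in>I. exp (f i)) \<le> ln ((\<Sum>i\<in>I. exp (g i)) * exp D)"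
    using assms by (subst ln_le_cancel_iff) (auto intro!: sum_pos mult_pos_pos)
  also have "\<dots> = ln (\<Sum>i\<in>I. exp (g i)) + D"
    using assms by (subst ln_mult) (auto intro!: sum_pos simp: less_imp_neq[THEN not_sym] sum_pos)
  finally show ?thesis .
qed

text \<open>The factor 2 collects one \<open>D\<close> from the entry \<open>c\<close> itself and
  one from the log-sum-exp normalization. The number of classes does not enter.\<close>

lemma ln_softmax_diff_le:
  assumes "v \<in> carrier_vec K" "w \<in> carrier_vec K" "c < K" "max_norm (v - w) \<le> D"
  shows "ln (softmax w $ c) - ln (softmax v $ c) \<le> 2 * D"
proof -
  have *: "\<bar>v $ j - w $ j\<bar> \<le> D" if "j < K" for j
    using max_norm_ge[of j "v - w"] assms that by auto
  have "ln (\<Sum>j\<in>{..<K}. exp (v $ j)) \<le> ln (\<Sum>j\<in>{..<K}. exp (w $ j)) + D"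
    using assms(3) *  by (intro ln_sum_exp_le) (fastforce simp: abs_le_iff)+
  then show ?thesis
    using *[OF assms(3)] assms by (simp add: ln_softmax)
qed

text \<open>The deterministic core, applied at a single outcome. Passing from parameter 1 to
  \<open>1 - h\<close> on the segment displaces the input of \<open>\<psi>2\<close> by
  \<open>h\<close> times \<open>R *\<^sub>v \<psi>1 s\<close> up to sign, so the data term costs at
  most \<open>h\<close> times a multiple of the mean of \<open>a_phi\<close>; the regularizer is an
  exact quadratic in \<open>h\<close>. After division by \<open>h\<close> the bound is affine in
  \<open>h\<close>, ready for the limit. The factorization is stated after \<open>softmax\<close>
  because the loss sees the logits only through it.\<close>

lemma loss_left_diff_quotient_le:
  fixes X :: "'s \<Rightarrow> params \<Rightarrow> real vec"
  assumes T: "finite T" "T \<noteq> {}" and C: "\<And>s. s \<in> T \<Longrightarrow> C s < K" and nl: "2 \<le> nl"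
    and S: "S \<in> carrier_mat N N" and R: "R \<in> carrier_mat N N"
    and split: "fst a 2 = S + R"
    and factor: "\<And>s \<theta>. s \<in> T \<Longrightarrow> \<theta> \<in> {0..1} \<Longrightarrow>
      softmax (X s (replace_W2 a (S + \<theta> \<cdot>\<^sub>m R))) = softmax (\<psi>2 ((S + \<theta> \<cdot>\<^sub>m R) *\<^sub>v \<psi>1 s))"
    and \<psi>1: "\<And>s. s \<in> T \<Longrightarrow> \<psi>1 s \<in> carrier_vec N"
    and \<psi>2: "\<And>v. v \<in> carrier_vec N \<Longrightarrow> \<psi>2 v \<in> carrier_vec K"
    and U: "\<And>s. s \<in> T \<Longrightarrow> U s \<subseteq> carrier_vec N"
      "\<And>s \<theta>. s \<in> T \<Longrightarrow> \<theta> \<in> {0..1} \<Longrightarrow> (S + \<theta> \<cdot>\<^sub>m R) *\<^sub>v \<psi>1 s \<in> U s"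
      "\<And>s. s \<in> T \<Longrightarrow> lip_const \<psi>2 (U s) < \<infinity>"
    and small: "\<And>s. s \<in> T \<Longrightarrow> max_norm (R *\<^sub>v \<psi>1 s) \<le> d1 * J (\<psi>1 s)"
    and h: "0 < h" "h < 1"
  shows "(loss X T C lam nl (replace_W2 a (S + (1 - h) \<cdot>\<^sub>m R)) - loss X T C lam nl a) / h
    \<le> 2 / real (card T) * (\<Sum>s\<in>T. a_phi J d1 (\<psi>1 s) \<psi>2 (U s))
      - 2 * lam * (frob_inner S R + (frob_norm R)\<^sup>2) + h * (lam * (frob_norm R)\<^sup>2)"
proof -
  define b where "b = replace_W2 a (S + (1 - h) \<cdot>\<^sub>m R)"
  define p where "p \<alpha> s = ln (softmax (X s \<alpha>) $ C s)" for \<alpha> s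
  \<comment> \<open>Writing the trained layer as the point with parameter 1 lets
    \<open>factor\<close> and \<open>U\<close> cover both ends of the comparison.\<close>
  have one: "1 \<cdot>\<^sub>m R = R" by (intro eq_matI) auto
  have a_eq: "a = replace_W2 a (S + 1 \<cdot>\<^sub>m R)"
    unfolding replace_W2_def using split S R
    by (metis fun_upd_triv one prod.collapse)
  have data: "p a s - p b s \<le> h * (2 * a_phi J d1 (\<psi>1 s) \<psi>2 (U s))" if s: "s \<in> T" for s
  proof -
    let ?v = "(S + (1 - h) \<cdot>\<^sub>m R) *\<^sub>v \<psi>1 s" and ?w = "(S + 1 \<cdot>\<^sub>m R) *\<^sub>v \<psi>1 s"
    let ?l = "enn2real (lip_const \<psi>2 (U s))"
    have v: "?v \<in> U s" "?w \<in> U s" using U(2)[OF s, of "1 - h"] U(2)[OF s, of 1] h by auto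
    have c: "?v \<in> carrier_vec N" "?w \<in> carrier_vec N" using v U(1)[OF s] by auto
    \<comment> \<open>The factor \<open>h\<close> arises here: the contribution of \<open>S\<close>
      cancels, and \<open>(1 - h) - 1 = - h\<close> is left in front of \<open>R\<close>.\<close>
    have entry: "(?v - ?w) $ i = - h * (R *\<^sub>v \<psi>1 s) $ i" if "i < N" for i
    proof -
      have "(?v - ?w) $ i = (\<Sum>j=0..<N. (S $$ (i, j) + (1 - h) * R $$ (i, j)) * \<psi>1 s $ j)
          - (\<Sum>j=0..<N. (S $$ (i, j) + R $$ (i, j)) * \<psi>1 s $ j)"
        using that S R \<psi>1[OF s] by (simp add: scalar_prod_def)
      also have "\<dots> = (\<Sum>j=0..<N. - h * (R $$ (i, j) * \<psi>1 s $ j))"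
        unfolding sum_subtractf[symmetric] by (intro sum.cong) (auto simp: algebra_simps)
      also have "\<dots> = - h * (R *\<^sub>v \<psi>1 s) $ i"
        using that R \<psi>1[OF s] unfolding sum_distrib_left[symmetric] by (simp add: scalar_prod_def)
      finally show ?thesis .
    qed
    have "max_norm (?v - ?w) \<le> h * max_norm (R *\<^sub>v \<psi>1 s)"
      unfolding max_norm_le_iff
    proof (intro conjI allI impI)
      fix i assume "i < dim_vec (?v - ?w)"
      then have i: "i < N" using R by auto
      then show "\<bar>(?v - ?w) $ i\<bar> \<le> h * max_norm (R *\<^sub>v \<psi>1 s)"
        unfolding entry[OF i] using h R max_norm_ge[of i "R *\<^sub>v \<psi>1 s"] by (simp add: abs_mult)
    qed (use h in simp)
    also have "\<dots> \<le> h * (d1 * J (\<psi>1 s))" using small[OF s] h by (intro mult_left_mono) auto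
    finally have "?l * max_norm (?v - ?w) \<le> ?l * (h * (d1 * J (\<psi>1 s)))"
      by (intro mult_left_mono) auto
    moreover have "max_norm (\<psi>2 ?v - \<psi>2 ?w) \<le> ?l * max_norm (?v - ?w)"
      using U[OF s] v \<psi>2[OF c(1)] by (intro max_norm_lip_const) auto
    ultimately have "max_norm (\<psi>2 ?v - \<psi>2 ?w) \<le> h * a_phi J d1 (\<psi>1 s) \<psi>2 (U s)"
      unfolding a_phi_def by (simp add: algebra_simps)
    from ln_softmax_diff_le[OF \<psi>2[OF c(1)] \<psi>2[OF c(2)] C[OF s] this]
    show ?thesis
      using factor[OF s, of "1 - h"] factor[OF s, of 1] a_eq h
      unfolding p_def b_def by (simp add: mult.left_commute)
  qed
  have "(\<Sum>s\<in>T. p a s) - (\<Sum>s\<in>T. p b s) \<le> (\<Sum>s\<in>T. h * (2 * a_phi J d1 (\<psi>1 s) \<psi>2 (U s)))"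
    unfolding sum_subtractf[symmetric] by (intro sum_mono data)
  also have "\<dots> = h * (2 * (\<Sum>s\<in>T. a_phi J d1 (\<psi>1 s) \<psi>2 (U s)))"
    by (simp add: sum_distrib_left)
  finally have 1: "1 / real (card T) * ((\<Sum>s\<in>T. p a s) - (\<Sum>s\<in>T. p b s))
      \<le> 1 / real (card T) * (h * (2 * (\<Sum>s\<in>T. a_phi J d1 (\<psi>1 s) \<psi>2 (U s))))"
    by (intro mult_left_mono) auto
  \<comment> \<open>Only the summand of layer 2 differs between \<open>a\<close> and
    \<open>b\<close>, so the rest of the regularizer cancels.\<close>
  have reg: "(\<Sum>i=1..nl. (frob_norm (fst c i))\<^sup>2)
      = (frob_norm (fst c 2))\<^sup>2 + (\<Sum>i\<in>{1..nl}-{2}. (frob_norm (fst c i))\<^sup>2)" for c :: params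
    using nl by (intro sum.remove) auto
  have 2: "(\<Sum>i=1..nl. (frob_norm (fst b i))\<^sup>2) - (\<Sum>i=1..nl. (frob_norm (fst a i))\<^sup>2)
      = (frob_norm (S + (1 - h) \<cdot>\<^sub>m R))\<^sup>2 - (frob_norm (S + 1 \<cdot>\<^sub>m R))\<^sup>2"
    using split S R unfolding reg b_def replace_W2_def by (simp add: one)
  \<comment> \<open>The squared norm of \<open>R\<close> is weighted by
    \<open>(1 - h)^2 - 1 = - 2 h + h^2\<close>; the part \<open>h^2\<close> is what survives as the
    linear term after division by \<open>h\<close>.\<close>
  also have "\<dots> = h * (- 2 * (frob_inner S R + (frob_norm R)\<^sup>2) + h * (frob_norm R)\<^sup>2)"
    unfolding frob_norm_power2_add_smult[OF S R] by (simp add: power2_eq_square algebra_simps)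
  finally have 2: "(\<Sum>i=1..nl. (frob_norm (fst b i))\<^sup>2) - (\<Sum>i=1..nl. (frob_norm (fst a i))\<^sup>2)
      = h * (- 2 * (frob_inner S R + (frob_norm R)\<^sup>2) + h * (frob_norm R)\<^sup>2)" .
  have "loss X T C lam nl b - loss X T C lam nl a
      = 1 / real (card T) * ((\<Sum>s\<in>T. p a s) - (\<Sum>s\<in>T. p b s))
        + lam * ((\<Sum>i=1..nl. (frob_norm (fst b i))\<^sup>2) - (\<Sum>i=1..nl. (frob_norm (fst a i))\<^sup>2))"
    unfolding loss_def p_def by (simp add: algebra_simps)
  also have "\<dots> \<le> h * (2 / real (card T) * (\<Sum>s\<in>T. a_phi J d1 (\<psi>1 s) \<psi>2 (U s))
      - 2 * lam * (frob_inner S R + (frob_norm R)\<^sup>2) + h * (lam * (frob_norm R)\<^sup>2))"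
    unfolding 2 using 1 by (simp add: algebra_simps)
  finally show ?thesis
    using h unfolding b_def by (simp add: pos_divide_le_eq mult.commute)
qed

text \<open>The lower limit is monotone under domination near 0, and the affine majorant converges
  to \<open>A\<close>, so the term \<open>h * B\<close> disappears.\<close>

lemma Liminf_at_right_le_of_affine:
  fixes f :: "real \<Rightarrow> real"
  assumes "\<And>h. 0 < h \<Longrightarrow> h < 1 \<Longrightarrow> f h \<le> A + h * B"
    and "Liminf (at_right 0) (\<lambda>h. ereal (f h)) \<ge> ereal c"
  shows "c \<le> A"
proof -
  have "((\<lambda>h. A + h * B) \<longlongrightarrow> A + 0 * B) (at_right 0)"
    by (intro tendsto_intros)
  then have "Liminf (at_right 0) (\<lambda>h. ereal (A + h * B)) = ereal A"
    by (intro lim_imp_Liminf) auto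
  moreover have "Liminf (at_right 0) (\<lambda>h. ereal (f h)) \<le> Liminf (at_right 0) (\<lambda>h. ereal (A + h * B))"
    using assms(1) by (intro Liminf_mono) (auto simp: eventually_at_right_field intro!: exI[of _ 1])
  ultimately show ?thesis using assms(2) by (simp add: order_trans) (metis ereal_less_eq(3) order_trans)
qed

subsection \<open>Conditional laws and atoms of the Frobenius norm\<close>

text \<open>The coordinates of \<open>\<psi>1 \<omega> s\<close> are among the generators of the
  information algebra. This makes the vector an admissible choice of \<open>v\<close> in hypothesis
  (iv).\<close>

lemma random_vec_info_algebra:
  assumes "\<And>\<omega>. \<omega> \<in> space M \<Longrightarrow> \<psi>1 \<omega> s \<in> carrier_vec N"
  shows "random_vec (info_algebra M N K S \<psi>1 \<psi>2) N (\<lambda>\<omega>. \<psi>1 \<omega> s)"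
proof -
  let ?G = "info_algebra M N K S \<psi>1 \<psi>2"
  have sp: "space ?G = space M" unfolding info_algebra_def by (simp add: space_measure_of_conv)
  show ?thesis
    unfolding random_vec_def sp
  proof (intro conjI ballI allI impI assms)
    fix i assume "i < N"
    then show "(\<lambda>\<omega>. \<psi>1 \<omega> s $ i) \<in> borel_measurable ?G"
      by (intro measurableI, simp_all add: sp)
        (unfold info_algebra_def, intro in_measure_of, auto)
  qed
qed

text \<open>Needed before any conditional expectation given the information algebra can be
  integrated; it suffices that the three families of generators consist of events.\<close>

lemma subalgebra_info_algebra:
  assumes "random_mat M N N S" "\<And>s. random_vec M N (\<lambda>\<omega>. \<psi>1 \<omega> s)"
    and "\<And>v. v \<in> carrier_vec N \<Longrightarrow> random_vec M K (\<lambda>\<omega>. \<psi>2 \<omega> v)"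
  shows "subalgebra M (info_algebra M N K S \<psi>1 \<psi>2)"
  unfolding subalgebra_def
proof
  show "space (info_algebra M N K S \<psi>1 \<psi>2) = space M"
    unfolding info_algebra_def by (simp add: space_measure_of_conv)
  have S: "(\<lambda>\<omega>. S \<omega> $$ (i, j)) -` B \<inter> space M \<in> sets M"
    if "i < N" "j < N" "B \<in> sets borel" for i j B
    using assms(1) that unfolding random_mat_def by (blast intro: measurable_sets)
  have \<psi>1: "(\<lambda>\<omega>. \<psi>1 \<omega> s $ i) -` B \<inter> space M \<in> sets M" if "i < N" "B \<in> sets borel" for s i B
    using assms(2)[of s] that unfolding random_vec_def by (blast intro: measurable_sets)
  have \<psi>2: "(\<lambda>\<omega>. \<psi>2 \<omega> v $ k) -` B \<inter> space M \<in> sets M"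
    if "v \<in> carrier_vec N" "k < K" "B \<in> sets borel" for v k B
    using assms(3)[OF that(1)] that(2,3) unfolding random_vec_def by (blast intro: measurable_sets)
  show "sets (info_algebra M N K S \<psi>1 \<psi>2) \<subseteq> sets M"
    unfolding info_algebra_def
  proof (subst sets_measure_of)
    show "sigma_sets (space M)
       ({(\<lambda>\<omega>. S \<omega> $$ (i, j)) -` B \<inter> space M | i j B. i < N \<and> j < N \<and> B \<in> sets borel}
        \<union> {(\<lambda>\<omega>. \<psi>1 \<omega> s $ i) -` B \<inter> space M | s i B. i < N \<and> B \<in> sets borel}
        \<union> {(\<lambda>\<omega>. \<psi>2 \<omega> v $ k) -` B \<inter> space M | v k B.
              v \<in> carrier_vec N \<and> k < K \<and> B \<in> sets borel}) \<subseteq> sets M"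
      by (rule sets.sigma_sets_subset) (auto simp: S \<psi>1 \<psi>2)
  qed auto
qed

section \<open>From conditional to unconditional probabilities\<close>

lemma (in prob_space) integral_cond_prob_alg:
  assumes "subalgebra M G" "A \<in> sets M"
  shows "integrable M (cond_prob_alg M G A)" "(\<integral>\<omega>. cond_prob_alg M G A \<omega> \<partial>M) = prob A"
proof -
  interpret finite_measure_subalgebra M G by unfold_locales (rule assms(1))
  have "integrable M (indicator A :: 'a \<Rightarrow> real)"
    using assms(2) by (simp add: integrable_indicator_iff emeasure_eq_measure)
  from real_cond_exp_int[OF this] show "integrable M (cond_prob_alg M G A)"
    "(\<integral>\<omega>. cond_prob_alg M G A \<omega> \<partial>M) = prob A"
    unfolding cond_prob_alg_def using assms(2) by (simp_all add: sets.Int_space_eq2)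
qed

text \<open>By the tower property the conditional probability integrates to the unconditional one,
  so an almost sure constant bound carries over. This is how (iv) is used.\<close>

lemma (in prob_space) prob_le_of_cond_prob_alg_le:
  assumes "subalgebra M G" "A \<in> sets M" "AE \<omega> in M. cond_prob_alg M G A \<omega> \<le> c"
  shows "prob A \<le> c"
  using integral_mono_AE[OF integral_cond_prob_alg(1)[OF assms(1,2)] integrable_const assms(3)]
  by (simp add: integral_cond_prob_alg(2)[OF assms(1,2)] prob_space)

lemma (in prob_space) prob_eq_of_cond_prob_alg_eq:
  assumes "subalgebra M G" "A \<in> sets M" "AE \<omega> in M. cond_prob_alg M G A \<omega> = c"
  shows "prob A = c"
proof -
  have "(\<integral>\<omega>. cond_prob_alg M G A \<omega> \<partial>M) = (\<integral>\<omega>. c \<partial>M)"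
    using assms(3) integral_cond_prob_alg(1)[OF assms(1,2)] by (intro integral_cong_AE) auto
  then show ?thesis by (simp add: integral_cond_prob_alg(2)[OF assms(1,2)] prob_space)
qed

lemma random_mat_rectangle_sets:
  assumes "random_mat M n m R" "\<And>i j. i < n \<Longrightarrow> j < m \<Longrightarrow> B i j \<in> sets borel"
  shows "{\<omega> \<in> space M. \<forall>i<n. \<forall>j<m. R \<omega> $$ (i, j) \<in> B i j} \<in> sets M"
proof -
  have *: "{\<omega> \<in> space M. R \<omega> $$ (i, j) \<in> B i j} \<in> sets M" if "i < n" "j < m" for i j
  proof -
    have "(\<lambda>\<omega>. R \<omega> $$ (i, j)) \<in> borel_measurable M"
      using assms(1) that unfolding random_mat_def by blast
    from measurable_sets[OF this assms(2)[OF that]] show ?thesis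
      by (simp add: vimage_def Int_def conj_commute)
  qed
  have "{\<omega> \<in> space M. \<forall>j\<in>{..<m}. R \<omega> $$ (i, j) \<in> B i j} \<in> sets M" if "i < n" for i
    by (rule sets.sets_Collect_finite_All[OF _ finite_lessThan]) (rule *[OF that], simp)
  then have "{\<omega> \<in> space M. \<forall>i\<in>{..<n}. \<forall>j\<in>{..<m}. R \<omega> $$ (i, j) \<in> B i j} \<in> sets M"
    by (rule sets.sets_Collect_finite_All[OF _ finite_lessThan]) (simp only: lessThan_iff)
  then show ?thesis by (simp only: Ball_def lessThan_iff)
qed

text \<open>The conditional probability of a rectangle is almost surely a constant, hence equal to
  its own mean, the unconditional probability.\<close>

lemma (in prob_space) cond_iid_entries_prob:
  assumes "subalgebra M G" "random_mat M n m R" "cond_iid_entries M G n m R \<mu>"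
    and "\<And>i j. i < n \<Longrightarrow> j < m \<Longrightarrow> B i j \<in> sets borel"
  shows "prob {\<omega> \<in> space M. \<forall>i<n. \<forall>j<m. R \<omega> $$ (i, j) \<in> B i j}
    = (\<Prod>i<n. \<Prod>j<m. measure \<mu> (B i j))"
proof -
  have "\<forall>i<n. \<forall>j<m. B i j \<in> sets borel" using assms(4) by simp
  with assms(3)[unfolded cond_iid_entries_def, THEN spec, of B]
  have "AE \<omega> in M. cond_prob_alg M G {\<omega> \<in> space M. \<forall>i<n. \<forall>j<m. R \<omega> $$ (i, j) \<in> B i j} \<omega>
      = (\<Prod>i<n. \<Prod>j<m. measure \<mu> (B i j))" by (rule mp)
  moreover have "{\<omega> \<in> space M. \<forall>i<n. \<forall>j<m. R \<omega> $$ (i, j) \<in> B i j} \<in> sets M"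
    by (rule random_mat_rectangle_sets[OF assms(2)]) (rule assms(4))
  ultimately show ?thesis by (intro prob_eq_of_cond_prob_alg_eq[OF assms(1)])
qed

text \<open>The remaining entries are padded with the whole line; their factors equal 1 because the
  law is a probability measure.\<close>

lemma (in prob_space) cond_iid_entries_prob_subset:
  assumes "subalgebra M G" "random_mat M n m R" "cond_iid_entries M G n m R \<mu>"
    and \<mu>: "prob_space \<mu>" "space \<mu> = UNIV"
    and J: "J \<subseteq> {..<n} \<times> {..<m}" and B: "\<And>p. p \<in> J \<Longrightarrow> B p \<in> sets borel"
  shows "prob {\<omega> \<in> space M. \<forall>p\<in>J. R \<omega> $$ p \<in> B p} = (\<Prod>p\<in>J. measure \<mu> (B p))"
proof -
  define B' where "B' p = (if p \<in> J then B p else UNIV)" for p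
  have "{\<omega> \<in> space M. \<forall>p\<in>J. R \<omega> $$ p \<in> B p}
      = {\<omega> \<in> space M. \<forall>i<n. \<forall>j<m. R \<omega> $$ (i, j) \<in> B' (i, j)}"
    using J unfolding B'_def by auto
  also have "prob \<dots> = (\<Prod>i<n. \<Prod>j<m. measure \<mu> (B' (i, j)))"
    using B by (intro cond_iid_entries_prob[OF assms(1-3)]) (auto simp: B'_def)
  also have "\<dots> = (\<Prod>p\<in>{..<n} \<times> {..<m}. measure \<mu> (B' p))"
    by (simp add: prod.cartesian_product)
  also have "\<dots> = (\<Prod>p\<in>J. measure \<mu> (B' p))"
    using J prob_space.prob_space[OF \<mu>(1)] \<mu>(2)
    by (intro prod.mono_neutral_right) (auto simp: B'_def)
  finally show ?thesis by (simp add: B'_def)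
qed

text \<open>Independence asks for the product formula on every finite subfamily of entries. The
  padded rectangles supply it, and their one-entry case identifies each factor as the probability of
  the corresponding single event.\<close>

lemma (in prob_space) cond_iid_entries_indep_vars:
  assumes "subalgebra M G" "random_mat M n m R" "cond_iid_entries M G n m R \<mu>"
    and \<mu>: "prob_space \<mu>" "space \<mu> = UNIV"
  shows "indep_vars (\<lambda>_. borel) (\<lambda>p \<omega>. R \<omega> $$ p) ({..<n} \<times> {..<m})"
  unfolding indep_vars_def2
proof (intro conjI ballI indep_setsI)
  fix p assume "p \<in> {..<n} \<times> {..<m}"
  then show "(\<lambda>\<omega>. R \<omega> $$ p) \<in> borel_measurable M"
    using assms(2) unfolding random_mat_def by auto
  then show "{(\<lambda>\<omega>. R \<omega> $$ p) -` A \<inter> space M |A. A \<in> sets borel} \<subseteq> events"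
    by (auto intro: measurable_sets)
next
  fix A J
  assume J: "J \<noteq> {}" "J \<subseteq> {..<n} \<times> {..<m}" "finite J"
    and A: "\<forall>p\<in>J. A p \<in> {(\<lambda>\<omega>. R \<omega> $$ p) -` A \<inter> space M |A. A \<in> sets borel}"
  from A have "\<forall>p\<in>J. \<exists>b. b \<in> sets borel \<and> A p = (\<lambda>\<omega>. R \<omega> $$ p) -` b \<inter> space M" by blast
  then obtain B where B: "\<And>p. p \<in> J \<Longrightarrow> B p \<in> sets borel"
      "\<And>p. p \<in> J \<Longrightarrow> A p = (\<lambda>\<omega>. R \<omega> $$ p) -` B p \<inter> space M"
    by (metis bchoice)
  have single: "prob (A p) = measure \<mu> (B p)" if "p \<in> J" for p
  proof -
    have "A p = {\<omega> \<in> space M. \<forall>q\<in>{p}. R \<omega> $$ q \<in> B q}" using B(2)[OF that] by auto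
    then show ?thesis
      using cond_iid_entries_prob_subset[OF assms, of "{p}" B] that J B(1) by auto
  qed
  have "(\<Inter>p\<in>J. A p) = {\<omega> \<in> space M. \<forall>p\<in>J. R \<omega> $$ p \<in> B p}"
    using J(1) B(2) by auto
  then have "prob (\<Inter>p\<in>J. A p) = (\<Prod>p\<in>J. measure \<mu> (B p))"
    using cond_iid_entries_prob_subset[OF assms J(2), of B] B(1) by auto
  also have "\<dots> = (\<Prod>p\<in>J. prob (A p))" by (simp add: single)
  finally show "prob (\<Inter>p\<in>J. A p) = (\<Prod>p\<in>J. prob (A p))" .
qed

text \<open>Fubini for the product law of the pair: the section of the line \<open>x + y = c\<close>
  at height \<open>y\<close> is the single point \<open>c - y\<close>, which is null for
  \<open>X\<close>. One atomless summand suffices.\<close>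

lemma (in prob_space) indep_var_add_atomless:
  fixes X Y :: "'a \<Rightarrow> real"
  assumes indep: "indep_var borel X borel Y"
    and X: "\<And>c. prob {\<omega> \<in> space M. X \<omega> = c} = 0"
  shows "prob {\<omega> \<in> space M. X \<omega> + Y \<omega> = c} = 0"
proof -
  have rv [measurable]: "X \<in> borel_measurable M" "Y \<in> borel_measurable M"
    and eq: "distr M borel X \<Otimes>\<^sub>M distr M borel Y = distr M (borel \<Otimes>\<^sub>M borel) (\<lambda>x. (X x, Y x))"
    using indep[unfolded indep_var_distribution_eq] by (blast, blast, blast)
  interpret DX: prob_space "distr M borel X" by (rule prob_space_distr) simp
  interpret DY: prob_space "distr M borel Y" by (rule prob_space_distr) simp
  interpret D: pair_prob_space "distr M borel X" "distr M borel Y" ..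
  let ?A = "{p. fst p + snd p = c} :: (real \<times> real) set"
  have "{p \<in> space (borel \<Otimes>\<^sub>M borel). fst p + snd p = c} \<in> sets (borel \<Otimes>\<^sub>M borel)"
    by measurable
  then have A [measurable]: "?A \<in> sets (borel \<Otimes>\<^sub>M borel)"
    by (simp add: space_pair_measure)
  have "emeasure M {\<omega> \<in> space M. X \<omega> + Y \<omega> = c}
      = emeasure (distr M (borel \<Otimes>\<^sub>M borel) (\<lambda>x. (X x, Y x))) ?A"
    by (subst emeasure_distr) (auto intro!: arg_cong[of _ _ "emeasure M"])
  also have "\<dots> = emeasure (distr M borel X \<Otimes>\<^sub>M distr M borel Y) ?A" by (simp only: eq)
  also have "\<dots> = (\<integral>\<^sup>+y. emeasure (distr M borel X) ((\<lambda>x. (x, y)) -` ?A) \<partial>distr M borel Y)"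
    by (subst D.emeasure_pair_measure_alt2) auto
  also have "\<dots> = (\<integral>\<^sup>+y. 0 \<partial>distr M borel Y)"
  proof (rule nn_integral_cong)
    fix y
    have "(\<lambda>x. (x, y)) -` ?A = {c - y}" by auto
    then show "emeasure (distr M borel X) ((\<lambda>x. (x, y)) -` ?A) = 0"
      using X[of "c - y"] by (simp add: emeasure_distr vimage_def Int_def conj_commute emeasure_eq_measure)
  qed
  finally show ?thesis by (simp add: emeasure_eq_measure)
qed

text \<open>The square of the atomless variable is split off; it is independent of the sum of the
  other squares, so the sum of the two has no atoms either.\<close>

lemma (in prob_space) indep_vars_sum_squares_atomless:
  fixes X :: "'i \<Rightarrow> 'a \<Rightarrow> real"
  assumes "finite I" "i \<in> I" and indep: "indep_vars (\<lambda>_. borel) X I"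
    and X: "\<And>c. prob {\<omega> \<in> space M. X i \<omega> = c} = 0"
  shows "prob {\<omega> \<in> space M. (\<Sum>j\<in>I. (X j \<omega>)\<^sup>2) = c} = 0"
proof -
  have [measurable]: "X i \<in> borel_measurable M"
    using indep assms(2) unfolding indep_vars_def by auto
  have "indep_vars (\<lambda>_. borel) (\<lambda>j \<omega>. (X j \<omega>)\<^sup>2) (insert i (I - {i}))"
    using indep_vars_compose2[OF indep, of "\<lambda>_ x. x\<^sup>2" "\<lambda>_. borel"] assms(2) by (simp add: insert_absorb)
  then have "indep_var borel (\<lambda>\<omega>. (X i \<omega>)\<^sup>2) borel (\<lambda>\<omega>. \<Sum>j\<in>I - {i}. (X j \<omega>)\<^sup>2)"
    using assms(1) by (intro indep_vars_sum) auto
  \<comment> \<open>A square can equal \<open>c\<close> only at the two points \<open>sqrt c\<close>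
    and \<open>- sqrt c\<close>, both of probability 0; for negative \<open>c\<close> it never
    does.\<close>
  moreover have "prob {\<omega> \<in> space M. (X i \<omega>)\<^sup>2 = c} = 0" for c
  proof -
    have "prob {\<omega> \<in> space M. (X i \<omega>)\<^sup>2 = c}
        \<le> prob ({\<omega> \<in> space M. X i \<omega> = sqrt c} \<union> {\<omega> \<in> space M. X i \<omega> = - sqrt c})"
      by (intro finite_measure_mono) (auto simp: real_sqrt_abs abs_if)
    also have "\<dots> \<le> prob {\<omega> \<in> space M. X i \<omega> = sqrt c} + prob {\<omega> \<in> space M. X i \<omega> = - sqrt c}"
      by (intro measure_Un_le) auto
    finally show ?thesis using X by (simp add: measure_le_0_iff)
  qed
  ultimately have "prob {\<omega> \<in> space M. (X i \<omega>)\<^sup>2 + (\<Sum>j\<in>I - {i}. (X j \<omega>)\<^sup>2) = c} = 0"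
    by (rule indep_var_add_atomless)
  then show ?thesis by (simp only: sum.remove[OF assms(1,2)])
qed

section \<open>The centered normal law and the norm of a Gaussian matrix\<close>

lemma prob_space_centered_normal: "v \<ge> 0 \<Longrightarrow> prob_space (centered_normal v)"
  unfolding centered_normal_def by (auto intro: prob_space_return prob_space_normal_density)

lemma space_centered_normal [simp]: "space (centered_normal v) = UNIV"
  unfolding centered_normal_def by simp

lemma centered_normal_singleton:
  assumes "v \<noteq> 0"
  shows "measure (centered_normal v) {c} = 0"
proof -
  have "{c} \<in> null_sets lborel" by (intro null_setsI) auto
  then have "{c} \<in> null_sets (density lborel (normal_density 0 (sqrt v)))"
    by (rule set_mp[OF absolutely_continuousI_density[unfolded absolutely_continuous_def], rotated]) simp
  then show ?thesis
    using assms unfolding centered_normal_def by (simp add: null_setsD1 measure_eq_0_null_sets)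
qed

text \<open>For positive variance the squared norm is a sum of independent squares of atomless
  entries. For variance 0 the matrix vanishes almost surely and the only atom of the norm is 0,
  which \<open>r > 0\<close> avoids.\<close>

lemma (in prob_space) cond_iid_normal_frob_norm_atomless:
  assumes "subalgebra M G" "random_mat M n n R" "cond_iid_entries M G n n R (centered_normal v)"
    and v: "v \<ge> 0" and n: "n \<ge> 1" and r: "r > 0"
  shows "prob {\<omega> \<in> space M. frob_norm (R \<omega>) = r} = 0"
proof (cases "v = 0")
  case True
  have "prob {\<omega> \<in> space M. \<forall>i<n. \<forall>j<n. R \<omega> $$ (i, j) \<in> {0}} = 1"
    using True by (subst cond_iid_entries_prob[OF assms(1-3)]) (auto simp: centered_normal_def measure_return)
  from AE_prob_1[OF this]
  have ae: "AE \<omega> in M. \<forall>i<n. \<forall>j<n. R \<omega> $$ (i, j) = 0"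
    by (rule eventually_mono) simp
  have "prob {\<omega> \<in> space M. frob_norm (R \<omega>) = r} \<le> prob {}"
  proof (rule finite_measure_mono_AE)
    show "AE \<omega> in M. \<omega> \<in> {\<omega> \<in> space M. frob_norm (R \<omega>) = r} \<longrightarrow> \<omega> \<in> {}"
      using ae
    proof eventually_elim
      case (elim \<omega>)
      have "frob_norm (R \<omega>) = 0" if "\<omega> \<in> space M"
        using elim assms(2) that unfolding random_mat_def frob_norm_def by auto
      then show ?case using r by auto
    qed
  qed simp
  then show ?thesis by (simp add: measure_le_0_iff)
next
  case False
  note cn = prob_space_centered_normal[OF v] space_centered_normal[of v]
  let ?I = "{..<n} \<times> {..<n}"
  \<comment> \<open>The entry \<open>(0, 0)\<close> exists because \<open>n \<ge> 1\<close>; it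
    serves as the atomless variable.\<close>
  have "prob {\<omega> \<in> space M. R \<omega> $$ (0, 0) = c} = 0" for c
    using cond_iid_entries_prob_subset[OF assms(1-3) cn, of "{(0, 0)}" "\<lambda>_. {c}"] n
    by (simp add: centered_normal_singleton[OF False])
  then have "prob {\<omega> \<in> space M. (\<Sum>p\<in>?I. (R \<omega> $$ p)\<^sup>2) = r\<^sup>2} = 0"
    using n by (intro indep_vars_sum_squares_atomless[of _ "(0, 0)"]
        cond_iid_entries_indep_vars[OF assms(1-3) cn]) auto
  moreover have "{\<omega> \<in> space M. frob_norm (R \<omega>) = r} = {\<omega> \<in> space M. (\<Sum>p\<in>?I. (R \<omega> $$ p)\<^sup>2) = r\<^sup>2}"
  proof -
    have "frob_norm (R \<omega>) = r \<longleftrightarrow> (\<Sum>p\<in>?I. (R \<omega> $$ p)\<^sup>2) = r\<^sup>2" if "\<omega> \<in> space M" for \<omega>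
    proof -
      have "frob_norm (R \<omega>) = sqrt (\<Sum>p\<in>?I. (R \<omega> $$ p)\<^sup>2)"
        using assms(2) that unfolding random_mat_def frob_norm_L2_set L2_set_def by auto
      moreover have "sqrt (\<Sum>p\<in>?I. (R \<omega> $$ p)\<^sup>2) = sqrt (r\<^sup>2) \<longleftrightarrow> (\<Sum>p\<in>?I. (R \<omega> $$ p)\<^sup>2) = r\<^sup>2"
        by (rule real_sqrt_eq_iff)
      ultimately show ?thesis using r by simp
    qed
    then show ?thesis by auto
  qed
  ultimately show ?thesis by simp
qed

section \<open>Convergence of distribution functions along the training path\<close>

lemma random_mat_frob_norm_measurable:
  assumes "random_mat M n m A"
  shows "(\<lambda>\<omega>. frob_norm (A \<omega>)) \<in> borel_measurable M"
proof -
  have "(\<lambda>\<omega>. sqrt (\<Sum>i<n. \<Sum>j<m. (A \<omega> $$ (i, j))\<^sup>2)) \<in> borel_measurable M"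
    using assms unfolding random_mat_def
    by (intro measurable_compose[OF _ borel_measurable_sqrt] borel_measurable_sum borel_measurable_power) auto
  also have "?this \<longleftrightarrow> ?thesis"
    using assms unfolding random_mat_def frob_norm_def by (intro measurable_cong) auto
  finally show ?thesis .
qed

text \<open>Convergence in probability gives convergence of distribution functions at continuity
  points of the limit law. If \<open>D t\<close> is at most \<open>d\<close>, the events
  \<open>Z t \<le> r\<close> and \<open>Y \<le> r\<close> can differ only where \<open>Y\<close>
  lies within \<open>d\<close> of \<open>r\<close>, and the absence of an atom at \<open>r\<close>
  makes that band improbable for small \<open>d\<close>.\<close>

lemma (in prob_space) tendsto_prob_le_of_in_prob:
  fixes Y :: "'a \<Rightarrow> real" and Z D :: "real \<Rightarrow> 'a \<Rightarrow> real"
  assumes [measurable]: "Y \<in> borel_measurable M" and Z: "\<And>t. t \<ge> 0 \<Longrightarrow> Z t \<in> borel_measurable M"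
    and D: "tends_to_0_in_prob (\<lambda>t. M) D at_top"
    and close: "\<And>t \<omega>. t \<ge> 0 \<Longrightarrow> \<omega> \<in> space M \<Longrightarrow> \<bar>Z t \<omega> - Y \<omega>\<bar> \<le> D t \<omega>"
    and atom: "prob {\<omega> \<in> space M. Y \<omega> = r} = 0"
  shows "((\<lambda>t. prob {\<omega> \<in> space M. Z t \<omega> \<le> r}) \<longlongrightarrow> prob {\<omega> \<in> space M. Y \<omega> \<le> r}) at_top"
proof (rule tendstoI)
  fix e :: real assume e: "e > 0"
  \<comment> \<open>The bands decrease to the event \<open>Y = r\<close>, so continuity from above
    makes their probability smaller than \<open>e / 2\<close>; this fixes the width \<open>d\<close>
    before \<open>t\<close> grows.\<close>
  define A where "A k = {\<omega> \<in> space M. \<bar>Y \<omega> - r\<bar> \<le> inverse (real (Suc k))}" for k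
  have "(\<lambda>k. prob (A k)) \<longlonglongrightarrow> prob (\<Inter>k. A k)"
  proof (rule finite_Lim_measure_decseq)
    show "decseq A"
    proof (rule decseq_SucI)
      have "inverse (real (Suc (Suc k))) \<le> inverse (real (Suc k))" for k
        by (rule le_imp_inverse_le) auto
      then show "A (Suc k) \<subseteq> A k" for k
        unfolding A_def by (blast intro: order_trans)
    qed
  qed (auto simp: A_def)
  moreover have "(\<Inter>k. A k) = {\<omega> \<in> space M. Y \<omega> = r}"
  proof -
    have "y = 0" if "\<forall>k. \<bar>y\<bar> \<le> inverse (real (Suc k))" for y :: real
      using that reals_Archimedean[of "\<bar>y\<bar>"] by (metis not_less zero_less_abs_iff)
    from this[of "Y _ - r"] show ?thesis unfolding A_def by auto
  qed
  ultimately have "(\<lambda>k. prob (A k)) \<longlonglongrightarrow> 0" using atom by simp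
  then have "eventually (\<lambda>k. prob (A k) < e / 2) sequentially"
    using e by (intro order_tendstoD) auto
  then obtain k where k: "prob (A k) < e / 2" by (auto simp: eventually_sequentially)
  define d where "d = inverse (real (Suc k))"
  have d: "d > 0" unfolding d_def by simp
  have "((\<lambda>t. prob {\<omega> \<in> space M. \<bar>D t \<omega>\<bar> > d}) \<longlongrightarrow> 0) at_top"
    using D d unfolding tends_to_0_in_prob_def by auto
  then have "eventually (\<lambda>t. prob {\<omega> \<in> space M. \<bar>D t \<omega>\<bar> > d} < e / 2) at_top"
    using e by (intro order_tendstoD) auto
  moreover have "eventually (\<lambda>t. D t \<in> borel_measurable M) at_top"
    using D unfolding tends_to_0_in_prob_def by auto
  ultimately show "eventually (\<lambda>t. dist (prob {\<omega> \<in> space M. Z t \<omega> \<le> r}) (prob {\<omega> \<in> space M. Y \<omega> \<le> r}) < e) at_top"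
    using eventually_ge_at_top[of 0]
  proof eventually_elim
    case (elim t)
    note [measurable] = elim(2) Z[OF elim(3)]
    let ?B = "{\<omega> \<in> space M. \<bar>D t \<omega>\<bar> > d}"
    have [measurable]: "A k \<in> sets M" unfolding A_def by measurable
    have "prob (A k \<union> ?B) \<le> prob (A k) + prob ?B" by (intro measure_Un_le) auto
    then have small: "prob (A k \<union> ?B) < e" using k elim(1) by simp
    \<comment> \<open>If \<open>Z t\<close> and \<open>Y\<close> lie on different sides of
      \<open>r\<close> and at distance at most \<open>d\<close>, then \<open>Y\<close> is within
      \<open>d\<close> of \<open>r\<close>.\<close>
    have "{\<omega> \<in> space M. Z t \<omega> \<le> r} \<subseteq> {\<omega> \<in> space M. Y \<omega> \<le> r} \<union> (A k \<union> ?B)"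
      "{\<omega> \<in> space M. Y \<omega> \<le> r} \<subseteq> {\<omega> \<in> space M. Z t \<omega> \<le> r} \<union> (A k \<union> ?B)"
      using close[OF elim(3)] unfolding A_def d_def[symmetric] by (auto simp: abs_le_iff not_less) (smt (verit))+
    then have "prob {\<omega> \<in> space M. Z t \<omega> \<le> r} \<le> prob ({\<omega> \<in> space M. Y \<omega> \<le> r} \<union> (A k \<union> ?B))"
      "prob {\<omega> \<in> space M. Y \<omega> \<le> r} \<le> prob ({\<omega> \<in> space M. Z t \<omega> \<le> r} \<union> (A k \<union> ?B))"
      by (intro finite_measure_mono; simp)+
    moreover have "prob ({\<omega> \<in> space M. Y \<omega> \<le> r} \<union> (A k \<union> ?B)) \<le> prob {\<omega> \<in> space M. Y \<omega> \<le> r} + prob (A k \<union> ?B)"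
      "prob ({\<omega> \<in> space M. Z t \<omega> \<le> r} \<union> (A k \<union> ?B)) \<le> prob {\<omega> \<in> space M. Z t \<omega> \<le> r} + prob (A k \<union> ?B)"
      by (intro measure_Un_le; simp)+
    ultimately show ?case using small unfolding dist_real_def by linarith
  qed
qed

subsection \<open>Vanishing of the random part\<close>

theorem theorem4p8:
  fixes K :: nat and T :: "'s set" and C :: "'s \<Rightarrow> nat" and lam :: real
    and M :: "nat \<Rightarrow> 'w measure"
    and nl nb :: "nat \<Rightarrow> nat" and nr nc :: "nat \<Rightarrow> nat \<Rightarrow> nat"
    and X :: "nat \<Rightarrow> 's \<Rightarrow> params \<Rightarrow> real vec"
    and \<alpha> :: "nat \<Rightarrow> real \<Rightarrow> 'w \<Rightarrow> params" and \<alpha>s :: "nat \<Rightarrow> 'w \<Rightarrow> params"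
    and S R :: "nat \<Rightarrow> 'w \<Rightarrow> real mat"
    and \<psi>1 :: "nat \<Rightarrow> 'w \<Rightarrow> 's \<Rightarrow> real vec"
    and \<psi>2 :: "nat \<Rightarrow> 'w \<Rightarrow> real vec \<Rightarrow> real vec"
    and g d1 d2 :: "nat \<Rightarrow> real" and J :: "real vec \<Rightarrow> real"
    and U :: "nat \<Rightarrow> 's \<Rightarrow> 'w \<Rightarrow> real vec set"
    and eps :: "nat \<Rightarrow> 'w \<Rightarrow> real"
  defines "G \<equiv> \<lambda>N. info_algebra (M N) N K (S N) (\<psi>1 N) (\<psi>2 N)"
    and "L \<equiv> \<lambda>N. loss (X N) T C lam (nl N)"
    and "\<alpha>\<theta> \<equiv> \<lambda>\<theta> N \<omega>. replace_W2 (\<alpha>s N \<omega>) (S N \<omega> + \<theta> \<cdot>\<^sub>m R N \<omega>)"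
  assumes T: "finite T" "T \<noteq> {}" and C: "\<And>s. s \<in> T \<Longrightarrow> C s < K" and lam: "lam > 0"
    and prob: "\<And>N. N \<ge> 1 \<Longrightarrow> prob_space (M N)"
    and arch: "\<And>N. N \<ge> 1 \<Longrightarrow> 2 \<le> nl N \<and> nr N 2 = N \<and> nc N 2 = N"
    and logits: "\<And>N s a. N \<ge> 1 \<Longrightarrow> a \<in> param_space (nl N) (nr N) (nc N) (nb N)
                   \<Longrightarrow> X N s a \<in> carrier_vec K"
    and path: "\<And>N t. N \<ge> 1 \<Longrightarrow> t \<ge> 0 \<Longrightarrow> random_params (M N) (nl N) (nr N) (nc N) (nb N) (\<alpha> N t)"
    and limit: "\<And>N. N \<ge> 1 \<Longrightarrow> random_params (M N) (nl N) (nr N) (nc N) (nb N) (\<alpha>s N)"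
    and S: "\<And>N. N \<ge> 1 \<Longrightarrow> random_mat (M N) N N (S N)"
    and R: "\<And>N. N \<ge> 1 \<Longrightarrow> random_mat (M N) N N (R N)"
    and \<psi>1: "\<And>N s. N \<ge> 1 \<Longrightarrow> random_vec (M N) N (\<lambda>\<omega>. \<psi>1 N \<omega> s)"
    and \<psi>2: "\<And>N v. N \<ge> 1 \<Longrightarrow> v \<in> carrier_vec N \<Longrightarrow> random_vec (M N) K (\<lambda>\<omega>. \<psi>2 N \<omega> v)"
    and i_conv: "\<And>N. N \<ge> 1 \<Longrightarrow>
           tends_to_0_in_prob (\<lambda>t. M N) (\<lambda>t \<omega>. param_dist (nl N) (\<alpha> N t \<omega>) (\<alpha>s N \<omega>)) at_top"
    and i_split: "\<And>N. N \<ge> 1 \<Longrightarrow> AE \<omega> in M N. fst (\<alpha>s N \<omega>) 2 = S N \<omega> + R N \<omega>"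
    and i_factor: "\<And>N. N \<ge> 1 \<Longrightarrow> AE \<omega> in M N. \<forall>s. \<forall>\<theta>\<in>{0..1}.
           softmax (X N s (\<alpha>\<theta> \<theta> N \<omega>))
           = softmax (\<psi>2 N \<omega> ((S N \<omega> + \<theta> \<cdot>\<^sub>m R N \<omega>) *\<^sub>v \<psi>1 N \<omega> s))"
    and ii: "\<And>N. N \<ge> 1 \<Longrightarrow> g N \<ge> 0"
            "\<And>N. N \<ge> 1 \<Longrightarrow> cond_iid_entries (M N) (G N) N N (R N) (centered_normal (g N / real N))"
    and iii: "\<And>N s. N \<ge> 1 \<Longrightarrow> s \<in> T \<Longrightarrow> AE \<omega> in M N.
           U N s \<omega> \<subseteq> carrier_vec N \<and>
           {(S N \<omega> + \<theta> \<cdot>\<^sub>m R N \<omega>) *\<^sub>v \<psi>1 N \<omega> s | \<theta>. \<theta> \<in> {0..1}} \<subseteq> U N s \<omega> \<and>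
           lip_const (\<psi>2 N \<omega>) (U N s \<omega>) < \<infinity>"
    and iv_nonneg: "\<And>N. N \<ge> 1 \<Longrightarrow> d1 N \<ge> 0 \<and> d2 N \<ge> 0" "\<And>v. J v \<ge> 0"
    and iv_lim: "d1 \<longlonglongrightarrow> 0" "d2 \<longlonglongrightarrow> 0"
    and iv: "\<And>N v. N \<ge> 1 \<Longrightarrow> random_vec (G N) N v \<Longrightarrow>
           (let A = {\<omega> \<in> space (M N). max_norm (R N \<omega> *\<^sub>v v \<omega>) > d1 N * J (v \<omega>)}
            in A \<in> sets (M N) \<and> (AE \<omega> in M N. cond_prob_alg (M N) (G N) A \<omega> \<le> d2 N))"
    and v: "\<And>s. s \<in> T \<Longrightarrow>
           tends_to_0_in_prob M (\<lambda>N \<omega>. a_phi J (d1 N) (\<psi>1 N \<omega> s) (\<psi>2 N \<omega>) (U N s \<omega>)) sequentially"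
    and vi: "tends_to_0_in_prob M (\<lambda>N \<omega>. frob_inner (S N \<omega>) (R N \<omega>)) sequentially"
    and vii_eps: "\<And>N \<omega>. N \<ge> 1 \<Longrightarrow> \<omega> \<in> space (M N) \<Longrightarrow> eps N \<omega> \<ge> 0"
                 "tends_to_0_in_prob M eps sequentially"
    and vii: "(\<lambda>N. measure (M N) {\<omega> \<in> space (M N).
           Liminf (at_right 0) (\<lambda>h. ereal ((L N (\<alpha>\<theta> (1 - h) N \<omega>) - L N (\<alpha>s N \<omega>)) / h))
             \<ge> ereal (- eps N \<omega>)}) \<longlonglongrightarrow> 1"
  shows "tends_to_0_in_prob M (\<lambda>N \<omega>. frob_norm (R N \<omega>)) sequentially \<and>
    (\<forall>St Rt :: nat \<Rightarrow> real \<Rightarrow> 'w \<Rightarrow> real mat.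
       (\<forall>N\<ge>1. \<forall>t\<ge>0. random_mat (M N) N N (St N t) \<and> random_mat (M N) N N (Rt N t) \<and>
          (AE \<omega> in M N. fst (\<alpha> N t \<omega>) 2 = St N t \<omega> + Rt N t \<omega>)) \<and>
       (\<forall>N\<ge>1. tends_to_0_in_prob (\<lambda>t. M N)
          (\<lambda>t \<omega>. frob_norm (St N t \<omega> - S N \<omega>) + frob_norm (Rt N t \<omega> - R N \<omega>)) at_top)
       \<longrightarrow> (\<forall>\<epsilon>>0. \<exists>l.
             (\<forall>N\<ge>1. ((\<lambda>t. measure (M N) {\<omega> \<in> space (M N). frob_norm (Rt N t \<omega>) \<le> \<epsilon>}) \<longlongrightarrow> l N) at_top) \<and>
             l \<longlonglongrightarrow> 1))"
proof -
  have sub: "subalgebra (M N) (G N)" if "N \<ge> 1" for N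
    unfolding G_def using S \<psi>1 \<psi>2 that by (intro subalgebra_info_algebra) auto
  have R_meas: "(\<lambda>\<omega>. frob_norm (R N \<omega>)) \<in> borel_measurable (M N)" if "N \<ge> 1" for N
    using random_mat_frob_norm_measurable[OF R[OF that]] .
  \<comment> \<open>The exceptional event of (iv) for the test vector
    \<open>\<psi>1 N \<omega> s\<close>; its probability is at most \<open>d2 N\<close>.\<close>
  define A where "A N s = {\<omega> \<in> space (M N). max_norm (R N \<omega> *\<^sub>v \<psi>1 N \<omega> s) > d1 N * J (\<psi>1 N \<omega> s)}" for N s
  have A: "A N s \<in> sets (M N)" "measure (M N) (A N s) \<le> d2 N" if N: "N \<ge> 1" for N s
  proof -
    interpret prob_space "M N" using prob[OF N] .
    have "random_vec (G N) N (\<lambda>\<omega>. \<psi>1 N \<omega> s)"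
      unfolding G_def using \<psi>1[OF N, of s]
      by (intro random_vec_info_algebra) (simp add: random_vec_def)
    from iv[OF N this] have "A N s \<in> sets (M N)"
        "AE \<omega> in M N. cond_prob_alg (M N) (G N) (A N s) \<omega> \<le> d2 N"
      unfolding A_def Let_def by blast+
    then show "A N s \<in> sets (M N)" "measure (M N) (A N s) \<le> d2 N"
      by (blast, rule prob_le_of_cond_prob_alg_le[OF sub[OF N]])
  qed
  define a where "a N s \<omega> = a_phi J (d1 N) (\<psi>1 N \<omega> s) (\<psi>2 N \<omega>) (U N s \<omega>)" for N s \<omega>
  define E where "E N = {\<omega> \<in> space (M N).
      Liminf (at_right 0) (\<lambda>h. ereal ((L N (\<alpha>\<theta> (1 - h) N \<omega>) - L N (\<alpha>s N \<omega>)) / h)) \<ge> ereal (- eps N \<omega>)}" for N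
  \<comment> \<open>The inequality holds only almost everywhere because the splitting, the
    factorization and the Lipschitz condition do; finiteness of \<open>T\<close> keeps the union of
    the null sets null.\<close>
  have key: "AE \<omega> in M N. (\<forall>s\<in>T. \<omega> \<notin> A N s) \<longrightarrow> \<omega> \<in> E N \<longrightarrow>
      2 * lam * (frob_norm (R N \<omega>))\<^sup>2
        \<le> eps N \<omega> + 2 / real (card T) * (\<Sum>s\<in>T. a N s \<omega>) - 2 * lam * frob_inner (S N \<omega>) (R N \<omega>)"
    if N: "N \<ge> 1" for N
  proof -
    have "AE \<omega> in M N. \<forall>s\<in>T. U N s \<omega> \<subseteq> carrier_vec N \<and>
           {(S N \<omega> + \<theta> \<cdot>\<^sub>m R N \<omega>) *\<^sub>v \<psi>1 N \<omega> s | \<theta>. \<theta> \<in> {0..1}} \<subseteq> U N s \<omega> \<and>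
           lip_const (\<psi>2 N \<omega>) (U N s \<omega>) < \<infinity>"
      using T(1) iii[OF N] by (intro AE_finite_allI) auto
    with i_split[OF N] i_factor[OF N] AE_space show ?thesis
    proof eventually_elim
      case (elim \<omega>)
      have c: "S N \<omega> \<in> carrier_mat N N" "R N \<omega> \<in> carrier_mat N N" "\<And>s. \<psi>1 N \<omega> s \<in> carrier_vec N"
          "\<And>v. v \<in> carrier_vec N \<Longrightarrow> \<psi>2 N \<omega> v \<in> carrier_vec K"
        using S[OF N] R[OF N] \<psi>1[OF N] \<psi>2[OF N] elim(3) unfolding random_mat_def random_vec_def by auto
      show ?case
      proof (intro impI)
        assume nA: "\<forall>s\<in>T. \<omega> \<notin> A N s" and E: "\<omega> \<in> E N"
        have small: "max_norm (R N \<omega> *\<^sub>v \<psi>1 N \<omega> s) \<le> d1 N * J (\<psi>1 N \<omega> s)" if "s \<in> T" for s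
          using nA elim(3) that unfolding A_def by auto
        let ?rhs = "2 / real (card T) * (\<Sum>s\<in>T. a N s \<omega>)
            - 2 * lam * (frob_inner (S N \<omega>) (R N \<omega>) + (frob_norm (R N \<omega>))\<^sup>2)"
        have "- eps N \<omega> \<le> ?rhs"
        proof (rule Liminf_at_right_le_of_affine)
          show "ereal (- eps N \<omega>) \<le> Liminf (at_right 0)
              (\<lambda>h. ereal ((L N (\<alpha>\<theta> (1 - h) N \<omega>) - L N (\<alpha>s N \<omega>)) / h))"
            using E unfolding E_def by simp
          fix h :: real assume h: "0 < h" "h < 1"
          show "(L N (\<alpha>\<theta> (1 - h) N \<omega>) - L N (\<alpha>s N \<omega>)) / h
              \<le> ?rhs + h * (lam * (frob_norm (R N \<omega>))\<^sup>2)"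
            unfolding L_def \<alpha>\<theta>_def a_def
          proof (rule loss_left_diff_quotient_le[where N = N and S = "S N \<omega>" and R = "R N \<omega>" and a = "\<alpha>s N \<omega>"
                and ?\<psi>1.0 = "\<psi>1 N \<omega>" and ?\<psi>2.0 = "\<psi>2 N \<omega>" and U = "\<lambda>s. U N s \<omega>" and X = "X N" and T = T
                and C = C and K = K and nl = "nl N" and J = J and ?d1.0 = "d1 N" and h = h,
                OF T C _ c(1,2) elim(1) _ c(3,4) _ _ _ small h])
            show "2 \<le> nl N" using arch[OF N] by simp
          next
            fix s and \<theta> :: real assume "\<theta> \<in> {0..1}"
            then show "softmax (X N s (replace_W2 (\<alpha>s N \<omega>) (S N \<omega> + \<theta> \<cdot>\<^sub>m R N \<omega>)))
                = softmax (\<psi>2 N \<omega> ((S N \<omega> + \<theta> \<cdot>\<^sub>m R N \<omega>) *\<^sub>v \<psi>1 N \<omega> s))"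
              using elim(2) unfolding \<alpha>\<theta>_def by blast
          next
            fix s and \<theta> :: real assume "s \<in> T" "\<theta> \<in> {0..1}"
            then show "(S N \<omega> + \<theta> \<cdot>\<^sub>m R N \<omega>) *\<^sub>v \<psi>1 N \<omega> s \<in> U N s \<omega>"
              using elim(4) by blast
          qed (use elim(4) in blast)+
        qed
        then show "2 * lam * (frob_norm (R N \<omega>))\<^sup>2
            \<le> eps N \<omega> + 2 / real (card T) * (\<Sum>s\<in>T. a N s \<omega>) - 2 * lam * frob_inner (S N \<omega>) (R N \<omega>)"
          by (simp add: algebra_simps)
      qed
    qed
  qed
  have part1: "tends_to_0_in_prob M (\<lambda>N \<omega>. frob_norm (R N \<omega>)) sequentially"
    unfolding tends_to_0_in_prob_def
  proof (intro conjI allI impI)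
    show "\<forall>\<^sub>F N in sequentially. (\<lambda>\<omega>. frob_norm (R N \<omega>)) \<in> borel_measurable (M N)"
      using eventually_ge_at_top[of 1] by eventually_elim (rule R_meas)
    fix \<epsilon> :: real assume \<epsilon>: "\<epsilon> > 0"
    \<comment> \<open>If the stationarity error, each \<open>a N s\<close> and the absolute inner
      product are at most \<open>\<delta>\<close>, the right side of \<open>key\<close> is at most
      \<open>\<delta> + 2 * \<delta> + 2 * lam * \<delta> = lam * \<epsilon>\<^sup>2\<close>. That
      is half of what a norm of size \<open>\<epsilon>\<close> would put on the left side, which
      leaves room for a contradiction.\<close>
    define \<delta> where "\<delta> = lam * \<epsilon>\<^sup>2 / (3 + 2 * lam)"
    have \<delta>: "\<delta> > 0" "(3 + 2 * lam) * \<delta> = lam * \<epsilon>\<^sup>2"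
      using lam \<epsilon> unfolding \<delta>_def by simp_all
    define exc where "exc Y N = {\<omega> \<in> space (M N). \<bar>Y N \<omega>\<bar> > \<delta>}" for Y :: "nat \<Rightarrow> 'w \<Rightarrow> real" and N
    let ?ip = "\<lambda>N \<omega>. frob_inner (S N \<omega>) (R N \<omega>)"
    \<comment> \<open>The union bound for all bad events. Each sample contributes two:
      \<open>a N s\<close> exceeding \<open>\<delta>\<close>, and the event
      \<open>A N s\<close>.\<close>
    define b where "b N = (1 - measure (M N) (E N)) + (measure (M N) (exc eps N)
        + (measure (M N) (exc ?ip N) + (\<Sum>s\<in>T. measure (M N) (exc (\<lambda>N. a N s) N) + d2 N)))" for N
    have exc: "(\<lambda>N. measure (M N) (exc Y N)) \<longlonglongrightarrow> 0"
        "\<forall>\<^sub>F N in sequentially. exc Y N \<in> sets (M N)"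
      if Y: "tends_to_0_in_prob M Y sequentially" for Y
    proof -
      show "(\<lambda>N. measure (M N) (exc Y N)) \<longlonglongrightarrow> 0"
        using Y \<delta>(1) unfolding tends_to_0_in_prob_def exc_def by blast
      have "\<forall>\<^sub>F N in sequentially. Y N \<in> borel_measurable (M N)"
        using Y unfolding tends_to_0_in_prob_def by blast
      then show "\<forall>\<^sub>F N in sequentially. exc Y N \<in> sets (M N)"
        unfolding exc_def by eventually_elim measurable
    qed
    have a_lim: "tends_to_0_in_prob M (\<lambda>N. a N s) sequentially" if "s \<in> T" for s
      using v[OF that] unfolding a_def .
    have E_lim: "(\<lambda>N. measure (M N) (E N)) \<longlonglongrightarrow> 1"
      using vii unfolding E_def .
    have "b \<longlonglongrightarrow> (1 - 1) + (0 + (0 + (\<Sum>s\<in>T. 0 + 0)))"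
      unfolding b_def[abs_def]
      by (intro tendsto_add tendsto_diff tendsto_const tendsto_sum E_lim exc(1) vii_eps(2) vi iv_lim(2) a_lim)
    then have b_lim: "b \<longlonglongrightarrow> 0" by simp
    have "\<forall>\<^sub>F N in sequentially. measure (M N) (E N) > 0"
      using order_tendstoD(1)[OF E_lim] by simp
    \<comment> \<open>Measurability of \<open>E N\<close> is extracted from (vii):
      \<open>measure\<close> is 0 on non-measurable sets, whereas here it is eventually
      positive.\<close>
    then have E_sets: "\<forall>\<^sub>F N in sequentially. E N \<in> sets (M N)"
      by eventually_elim (metis less_irrefl measure_notin_sets)
    have a_sets: "\<forall>\<^sub>F N in sequentially. \<forall>s\<in>T. exc (\<lambda>N. a N s) N \<in> sets (M N)"
      using T(1) exc(2)[OF a_lim] by (intro eventually_ball_finite) auto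
    have bound: "\<forall>\<^sub>F N in sequentially. measure (M N) {\<omega> \<in> space (M N). \<bar>frob_norm (R N \<omega>)\<bar> > \<epsilon>} \<le> b N"
      using eventually_ge_at_top[of 1] E_sets a_sets exc(2)[OF vii_eps(2)] exc(2)[OF vi]
    proof eventually_elim
      case (elim N)
      interpret prob_space "M N" using prob[OF elim(1)] .
      let ?D = "\<lambda>s. exc (\<lambda>N. a N s) N \<union> A N s"
      \<comment> \<open>Outside \<open>?B\<close> the estimate of \<open>key\<close> contradicts a
        norm larger than \<open>\<epsilon>\<close>. The inclusion in \<open>?B\<close> is only
        almost sure, which is enough to compare probabilities.\<close>
      let ?B = "(space (M N) - E N) \<union> (exc eps N \<union> (exc ?ip N \<union> (\<Union>s\<in>T. ?D s)))"
      have D: "?D s \<in> sets (M N)" if "s \<in> T" for s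
        using elim(3) A(1)[OF elim(1)] that by auto
      have UD: "(\<Union>s\<in>T. ?D s) \<in> sets (M N)"
        using T(1) D by (intro sets.finite_UN) auto
      have "AE \<omega> in M N. \<omega> \<in> {\<omega> \<in> space (M N). \<bar>frob_norm (R N \<omega>)\<bar> > \<epsilon>} \<longrightarrow> \<omega> \<in> ?B"
        using key[OF elim(1)]
      proof eventually_elim
        case (elim \<omega>)
        show ?case
        proof (intro impI, rule ccontr)
          assume \<omega>: "\<omega> \<in> {\<omega> \<in> space (M N). \<bar>frob_norm (R N \<omega>)\<bar> > \<epsilon>}" and nB: "\<omega> \<notin> ?B"
          have nA: "\<forall>s\<in>T. \<omega> \<notin> A N s" and nE: "\<omega> \<in> E N" using \<omega> nB by auto
          have le: "eps N \<omega> \<le> \<delta>" "\<bar>?ip N \<omega>\<bar> \<le> \<delta>" "\<And>s. s \<in> T \<Longrightarrow> a N s \<omega> \<le> \<delta>"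
            using \<omega> nB unfolding exc_def by force+
          have "(\<Sum>s\<in>T. a N s \<omega>) \<le> real (card T) * \<delta>"
            using le(3) by (intro sum_bounded_above) auto
          then have "2 / real (card T) * (\<Sum>s\<in>T. a N s \<omega>) \<le> 2 / real (card T) * (real (card T) * \<delta>)"
            by (intro mult_left_mono) auto
          also have "\<dots> = 2 * \<delta>" using T by simp
          finally have "2 / real (card T) * (\<Sum>s\<in>T. a N s \<omega>) \<le> 2 * \<delta>" .
          moreover have "lam * - ?ip N \<omega> \<le> lam * \<delta>"
            using le(2) lam by (intro mult_left_mono) auto
          ultimately have "2 * lam * (frob_norm (R N \<omega>))\<^sup>2 \<le> (3 + 2 * lam) * \<delta>"
            using elim nA nE le(1) by (simp add: algebra_simps)
          then have "2 * (frob_norm (R N \<omega>))\<^sup>2 \<le> \<epsilon>\<^sup>2"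
            unfolding \<delta>(2) using lam by simp
          moreover have "\<epsilon>\<^sup>2 < (frob_norm (R N \<omega>))\<^sup>2"
            using \<omega> \<epsilon> by (intro power_strict_mono) auto
          ultimately show False using \<epsilon> zero_le_power2[of \<epsilon>] by linarith
        qed
      qed
      then have "prob {\<omega> \<in> space (M N). \<bar>frob_norm (R N \<omega>)\<bar> > \<epsilon>} \<le> prob ?B"
        using elim UD by (intro finite_measure_mono_AE) auto
      also have "\<dots> \<le> prob (space (M N) - E N) + (prob (exc eps N) + (prob (exc ?ip N) + prob (\<Union>s\<in>T. ?D s)))"
        using elim UD by (intro order_trans[OF measure_Un_le] add_left_mono sets.Un) auto
      also have "prob (\<Union>s\<in>T. ?D s) \<le> (\<Sum>s\<in>T. prob (?D s))"
        using T(1) D by (intro measure_UNION_le) auto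
      also have "\<dots> \<le> (\<Sum>s\<in>T. prob (exc (\<lambda>N. a N s) N) + d2 N)"
        using elim(3) A[OF elim(1)]
        by (intro sum_mono order_trans[OF measure_Un_le] add_left_mono) auto
      finally show ?case unfolding b_def using elim(2) by (simp add: prob_compl)
    qed
    show "(\<lambda>N. measure (M N) {\<omega> \<in> space (M N). \<bar>frob_norm (R N \<omega>)\<bar> > \<epsilon>}) \<longlonglongrightarrow> 0"
      by (rule tendsto_sandwich[OF _ bound tendsto_const b_lim]) simp
  qed
  \<comment> \<open>The inner limit is \<open>l N\<close>, the probability that the norm of
    \<open>R N\<close> is at most \<open>\<epsilon>\<close>. It exists for every fixed
    \<open>N \<ge> 1\<close> since \<open>\<epsilon> > 0\<close> is not an atom of that
    norm.\<close>
  moreover have "\<exists>l. (\<forall>N\<ge>1. ((\<lambda>t. measure (M N) {\<omega> \<in> space (M N). frob_norm (Rt N t \<omega>) \<le> \<epsilon>}) \<longlongrightarrow> l N) at_top) \<and> l \<longlonglongrightarrow> 1"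
    if rand: "\<And>N t. N \<ge> 1 \<Longrightarrow> t \<ge> 0 \<Longrightarrow> random_mat (M N) N N (St N t) \<and> random_mat (M N) N N (Rt N t)"
      and conv: "\<And>N. N \<ge> 1 \<Longrightarrow> tends_to_0_in_prob (\<lambda>t. M N)
          (\<lambda>t \<omega>. frob_norm (St N t \<omega> - S N \<omega>) + frob_norm (Rt N t \<omega> - R N \<omega>)) at_top"
      and \<epsilon>: "\<epsilon> > 0"
    for St Rt :: "nat \<Rightarrow> real \<Rightarrow> 'w \<Rightarrow> real mat" and \<epsilon> :: real
  proof (intro exI conjI allI impI)
    fix N :: nat assume N: "N \<ge> 1"
    interpret prob_space "M N" using prob[OF N] .
    show "((\<lambda>t. prob {\<omega> \<in> space (M N). frob_norm (Rt N t \<omega>) \<le> \<epsilon>})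
        \<longlongrightarrow> prob {\<omega> \<in> space (M N). frob_norm (R N \<omega>) \<le> \<epsilon>}) at_top"
    proof (rule tendsto_prob_le_of_in_prob[OF R_meas[OF N] _ conv[OF N]])
      fix t :: real and \<omega> assume t: "t \<ge> 0" and \<omega>: "\<omega> \<in> space (M N)"
      have "\<bar>frob_norm (Rt N t \<omega>) - frob_norm (R N \<omega>)\<bar> \<le> frob_norm (Rt N t \<omega> - R N \<omega>)"
        using rand[OF N t] R[OF N] \<omega> unfolding random_mat_def by (intro frob_norm_triangle_sub) auto
      then show "\<bar>frob_norm (Rt N t \<omega>) - frob_norm (R N \<omega>)\<bar>
          \<le> frob_norm (St N t \<omega> - S N \<omega>) + frob_norm (Rt N t \<omega> - R N \<omega>)"
        by (simp add: add_increasing)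
    next
      show "prob {\<omega> \<in> space (M N). frob_norm (R N \<omega>) = \<epsilon>} = 0"
        by (rule cond_iid_normal_frob_norm_atomless[OF sub[OF N] R[OF N] ii(2)[OF N] _ N \<epsilon>])
          (use ii(1)[OF N] in simp)
    qed (use rand[OF N] random_mat_frob_norm_measurable in blast)
  next
    \<comment> \<open>The outer limit is the first claim read through complements.\<close>
    have "(\<lambda>N. measure (M N) {\<omega> \<in> space (M N). \<bar>frob_norm (R N \<omega>)\<bar> > \<epsilon>}) \<longlonglongrightarrow> 0"
      using part1 \<epsilon> unfolding tends_to_0_in_prob_def by blast
    from tendsto_diff[OF tendsto_const[of 1] this]
    have "(\<lambda>N. 1 - measure (M N) {\<omega> \<in> space (M N). \<bar>frob_norm (R N \<omega>)\<bar> > \<epsilon>}) \<longlonglongrightarrow> 1" by simp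
    moreover have "\<forall>\<^sub>F N in sequentially. 1 - measure (M N) {\<omega> \<in> space (M N). \<bar>frob_norm (R N \<omega>)\<bar> > \<epsilon>}
        = measure (M N) {\<omega> \<in> space (M N). frob_norm (R N \<omega>) \<le> \<epsilon>}"
      using eventually_ge_at_top[of 1]
    proof eventually_elim
      case (elim N)
      interpret prob_space "M N" using prob[OF elim] .
      note [measurable] = R_meas[OF elim]
      have "{\<omega> \<in> space (M N). frob_norm (R N \<omega>) \<le> \<epsilon>}
          = space (M N) - {\<omega> \<in> space (M N). \<bar>frob_norm (R N \<omega>)\<bar> > \<epsilon>}" by auto
      then show ?case by (simp add: prob_compl)
    qed
    ultimately show "(\<lambda>N. measure (M N) {\<omega> \<in> space (M N). frob_norm (R N \<omega>) \<le> \<epsilon>}) \<longlonglongrightarrow> 1"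
      by (rule Lim_transform_eventually)
  qed
  ultimately show ?thesis by blast
qed

end
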